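(* Let $a,b$ be positive integers. The state $(a,b)$ is pourable if and only if there is a positive integer $k$ with $(a+b)/\gcd(a,b)=2^k$.
   Context: Let $\mathbb{N}$ denote the positive integers and $\mathbb{N}_0=\mathbb{N}\cup\{0\}$. The two-dimensional pouring function $f:\mathbb{N}^2\to\mathbb{N}_0^2$ is defined by $f(a,b)=(2a,b-a)$ if $a\le b$, and $f(a,b)=(a-b,2b)$ otherwise. A state $(a,b)\in\mathbb{N}^2$ is called pourable if there is $p\in\mathbb{N}$ with $f^p(a,b)=(a+b,0)$, where $f^p$ is the $p$-fold iterate of $f$ (all intermediate iterates lying in $\mathbb{N}^2$). *)

theory Defs
  imports Complex_Main
begin

text \<open>
  The pouring function maps pairs of positive integers to pairs of nonnegative integers.
  Here it is a total function on pairs of naturals; only its values on pairs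
  with both components positive matter, since \<open>pourable\<close> demands that it is only ever applied
  to such pairs.
\<close>

definition pour :: "nat \<times> nat \<Rightarrow> nat \<times> nat" where
  "pour = (\<lambda>(a, b). if a \<le> b then (2 * a, b - a) else (a - b, 2 * b))"

definition positive_states :: "(nat \<times> nat) set" where
  "positive_states = {0<..} \<times> {0<..}"

definition pourable :: "nat \<Rightarrow> nat \<Rightarrow> bool" where
  "pourable a b \<longleftrightarrow>
     (\<exists>p>0. (\<forall>i<p. (pour ^^ i) (a, b) \<in> positive_states) \<and> (pour ^^ p) (a, b) = (a + b, 0))"

end

theory Submission
  imports Defs "HOL-Number_Theory.Cong"
begin

text \<open>
  The total \<open>N = a + b\<close> is invariant, and each step doubles both components modulo \<open>N\<close>,
  because \<open>b - a = 2b - N\<close> and \<open>a - b = 2a - N\<close>. So after \<open>i\<close> steps the state is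
  congruent to \<open>(2^i a, 2^i b)\<close>. Reaching \<open>(N, 0)\<close> forces \<open>N\<close> to divide
  \<open>2^p gcd(a,b)\<close>. Conversely, if \<open>N = 2^k gcd(a,b)\<close>, then \<open>N\<close> divides the \<open>k\<close>-th iterate,
  so the play leaves the positive states by then, and it can only do so at \<open>(N, 0)\<close>.
\<close>

lemma pour_sum: "fst (pour s) + snd (pour s) = fst s + snd s"
  by (cases s) (auto simp: pour_def)

lemma pour_cong:
  "[fst (pour s) = 2 * fst s] (mod (fst s + snd s))"
  "[snd (pour s) = 2 * snd s] (mod (fst s + snd s))"
proof -
  obtain x y where s: "s = (x, y)" by (cases s)
  \<comment> \<open>The component that \<open>pour\<close> doubles satisfies its congruence
    outright; \<open>diff\<close> handles the other one, whichever branch is taken. The guard keeps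
    the subtraction from truncating.\<close>
  have diff: "[n - m = 2 * n] (mod (n + m))" if "m \<le> n" for m n :: nat
  proof -
    have "2 * n = (n - m) + (n + m)" using that by simp
    then show ?thesis by (metis cong_def mod_add_self2)
  qed
  show "[fst (pour s) = 2 * fst s] (mod (fst s + snd s))"
    using diff[of y x] by (auto simp: s pour_def)
  show "[snd (pour s) = 2 * snd s] (mod (fst s + snd s))"
    using diff[of x y] by (auto simp: s pour_def add.commute)
qed

lemma funpow_pour_sum: "fst ((pour ^^ i) s) + snd ((pour ^^ i) s) = fst s + snd s"
  by (induction i) (simp_all add: pour_sum)

lemma funpow_pour_cong:
  "[fst ((pour ^^ i) s) = 2 ^ i * fst s] (mod (fst s + snd s))"
  "[snd ((pour ^^ i) s) = 2 ^ i * snd s] (mod (fst s + snd s))"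
proof (induction i)
  case (Suc i)
  have step: "[fst ((pour ^^ Suc i) s) = 2 * fst ((pour ^^ i) s)] (mod (fst s + snd s))"
    "[snd ((pour ^^ Suc i) s) = 2 * snd ((pour ^^ i) s)] (mod (fst s + snd s))"
    using pour_cong[of "(pour ^^ i) s"] by (simp_all add: funpow_pour_sum)
  { case 1
    show ?case using cong_trans[OF step(1) cong_scalar_left[OF Suc.IH(1)]]
      by (simp add: mult.assoc) }
  { case 2
    show ?case using cong_trans[OF step(2) cong_scalar_left[OF Suc.IH(2)]]
      by (simp add: mult.assoc) }
qed simp_all

text \<open>The branch for \<open>a > b\<close> keeps both components positive, so an exit happens
  only at \<open>a = b\<close>, where the first branch empties the second component.\<close>

lemma pour_leaves_positive:
  assumes "s \<in> positive_states" "pour s \<notin> positive_states"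
  shows "pour s = (fst s + snd s, 0)"
  using assms by (cases s) (auto simp: pour_def positive_states_def split: if_splits)

lemma pourable_dvd:
  assumes "pourable a b"
  shows "\<exists>p. a + b dvd 2 ^ p * gcd a b"
proof -
  obtain p where "(pour ^^ p) (a, b) = (a + b, 0)"
    using assms by (auto simp: pourable_def)
  then have "[a + b = 2 ^ p * a] (mod (a + b))" "[0 = 2 ^ p * b] (mod (a + b))"
    using funpow_pour_cong[of p "(a, b)"] by simp_all
  then have "a + b dvd 2 ^ p * a" "a + b dvd 2 ^ p * b"
    by (simp_all add: cong_def mod_eq_0_iff_dvd)
  then have "a + b dvd gcd (2 ^ p * a) (2 ^ p * b)" by (rule gcd_greatest)
  then show ?thesis by (auto simp: gcd_mult_distrib_nat)
qed

lemma pourable_if_dvd: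
  assumes "a > 0" "b > 0" "a + b dvd 2 ^ k * a"
  shows "pourable a b"
proof -
  let ?s = "\<lambda>i. (pour ^^ i) (a, b)"
  \<comment> \<open>In a positive state the first component lies strictly between 0 and the total,
    so it cannot be a multiple of \<open>a + b\<close>.\<close>
  have "?s k \<notin> positive_states"
  proof
    assume "?s k \<in> positive_states"
    then have pos: "fst (?s k) > 0" "snd (?s k) > 0"
      by (auto simp: positive_states_def mem_Times_iff)
    have "a + b dvd fst (?s k)"
      using funpow_pour_cong(1)[of k "(a, b)"] assms(3)
      by (simp add: cong_def dvd_eq_mod_eq_0)
    then have "a + b \<le> fst (?s k)" using pos by (simp add: dvd_imp_le)
    then show False using funpow_pour_sum[of k "(a, b)"] pos by simp
  qed
  \<comment> \<open>Take the first exit time: its predecessor is still positive, and it is not 0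
    because the play starts in a positive state.\<close>
  then obtain p where p: "?s p \<notin> positive_states" "\<forall>i<p. ?s i \<in> positive_states"
    using exists_least_iff[of "\<lambda>i. ?s i \<notin> positive_states"] by blast
  have "?s 0 \<in> positive_states" using assms by (simp add: positive_states_def)
  with p obtain q where q: "p = Suc q" by (cases p) auto
  have "?s p = (fst (?s q) + snd (?s q), 0)"
    using pour_leaves_positive[of "?s q"] p by (simp add: q)
  then have "?s p = (a + b, 0)" by (simp add: funpow_pour_sum)
  with p q show ?thesis unfolding pourable_def by blast
qed

theorem theorem9:
  fixes a b :: nat
  assumes "a > 0" and "b > 0"
  shows "pourable a b \<longleftrightarrow> (\<exists>k::nat. k > 0 \<and> (a + b) div gcd a b = 2 ^ k)"
proof -
  define m where "m = (a + b) div gcd a b"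
  have g: "gcd a b > 0" using assms by simp
  have "gcd a b dvd a + b" by simp
  then have m: "a + b = m * gcd a b" unfolding m_def by (rule dvd_div_mult_self[symmetric])
  have "pourable a b \<longleftrightarrow> (\<exists>k>0. m = 2 ^ k)"
  proof
    assume "pourable a b"
    \<comment> \<open>Cancel the positive factor \<open>gcd a b\<close> from both sides of the
      divisibility.\<close>
    then obtain p where "m dvd 2 ^ p"
      using pourable_dvd[of a b] g by (auto simp: m)
    then obtain k where k: "m = 2 ^ k"
      using divides_primepow_nat[OF two_is_prime_nat] by blast
    have "k \<noteq> 0"
    proof
      assume "k = 0"
      then have "a + b = gcd a b" using m k by simp
      also have "\<dots> \<le> a" using assms by (simp add: gcd_le1_nat)
      finally show False using assms by simp
    qed
    with k show "\<exists>k>0. m = 2 ^ k" by blast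
  next
    assume "\<exists>k>0. m = 2 ^ k"
    then obtain k where "m = 2 ^ k" by blast
    then have "a + b dvd 2 ^ k * a" using m by (simp add: mult_dvd_mono)
    then show "pourable a b" by (rule pourable_if_dvd[OF assms])
  qed
  then show ?thesis unfolding m_def .
qed

end
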